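(* Consider a second-order ordinary differential equation of the form $$y''+F_2(x,y)\,{y'}^2+F_1(x,y)\,y'+F(x,y)=0, \qquad ( * )$$ and assume that $( * )$ is S-linearizable. Let $$h(x,y)=\int F_2(x,y)\,dy+g(x),$$ where $g(x)$ is a function of $x$ alone for which $$(F_1)_x+F_1h_x-h_x^2-h_{xx}-F_y-F\,F_2=0$$ holds identically in $(x,y)$. Then $( * )$ has the first integral $w(x,y,y')=A(x,y)\,y'+B(x,y)$, where $$A(x,y)=e^{h},\qquad B(x,y)=\int F\,e^{h}\,dx+\int\left(e^{h}(F_1-h_x)-\int e^{h}\,(F_y+F\,F_2)\,dx\right)dy .$$
   Context: Subscripts $x$ and $y$ on functions denote partial derivatives (so $(F_1)_x=\partial F_1/\partial x$, $h_x=\partial h/\partial x$, $F_y=\partial F/\partial y$, etc.), while $F_1,F_2$ are just names of coefficients; $y=y(x)$ and $'=d/dx$. All functions are smooth and real-valued, and all statements are local: fix a point $(x_0,y_0)$; everything is understood on some sufficiently small open rectangle around $(x_0,y_0)$. Convention on integrals: in the definition of $h$, $\int F_2\,dy$ is any fixed antiderivative of $F_2$ with respect to $y$. In the formula for $B$, the integrals $\int\cdot\,dx$ (both occurrences) and $\int\cdot\,dy$ are antiderivatives taken from fixed base points, $\int_{x_0}^x\cdot\,dx$ and $\int_{y_0}^y\cdot\,dy$ respectively, with the same base point $x_0$ in both $x$-integrals. A first integral of $( * )$ is a function $w(x,y,y')$ such that $\frac{d}{dx}w(x,y(x),y'(x))=0$ for every solution $y(x)$ of $( * )$. A generalized Sundman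 transformation (S-transformation) is a (generally nonlocal) transformation $$u(t)=\psi(x,y),\qquad dt=\phi(x,y)\,dx,\qquad \psi_y\,\phi\neq 0 .$$ Under it, $u_t=\dfrac{\psi_x+\psi_y y'}{\phi}$ and $u_{tt}=\dfrac1\phi\,\dfrac{d}{dx}\!\left(\dfrac{\psi_x+\psi_y y'}{\phi}\right)$. The equation $( * )$ is called S-linearizable if it can be transformed into the free particle (Laguerre form) equation $u_{tt}=0$ by some generalized Sundman transformation. Equivalently, there exist functions $\psi,\phi$ with $\psi_y\phi\neq0$ such that, with $\tilde A=\psi_y/\phi$ and $\tilde B=\psi_x/\phi$, $$\tilde A F_2=\tilde A_y,\qquad \tilde A F_1=\tilde B_y+\tilde A_x,\qquad \tilde A F=\tilde B_x .$$ *)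

theory Defs
  imports "HOL-Analysis.Analysis"
begin

definition partial_x :: "(real \<Rightarrow> real \<Rightarrow> real) \<Rightarrow> real \<Rightarrow> real \<Rightarrow> real" where
  "partial_x f x y = deriv (\<lambda>s. f s y) x"

definition partial_y :: "(real \<Rightarrow> real \<Rightarrow> real) \<Rightarrow> real \<Rightarrow> real \<Rightarrow> real" where
  "partial_y f x y = deriv (\<lambda>s. f x s) y"

text \<open>Class \<open>C\<^sup>k\<close> on an open set \<open>U\<close> of the plane: all iterated (mixed) partial derivatives
  up to order \<open>k\<close> exist and are continuous on \<open>U\<close>.\<close>

primrec Ck_on :: "nat \<Rightarrow> (real \<times> real) set \<Rightarrow> (real \<Rightarrow> real \<Rightarrow> real) \<Rightarrow> bool" where
  "Ck_on 0 U f \<longleftrightarrow> continuous_on U (\<lambda>(x, y). f x y)"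
| "Ck_on (Suc k) U f \<longleftrightarrow>
     continuous_on U (\<lambda>(x, y). f x y) \<and>
     (\<forall>(x, y)\<in>U. (\<lambda>s. f s y) differentiable (at x) \<and> (\<lambda>s. f x s) differentiable (at y)) \<and>
     Ck_on k U (partial_x f) \<and> Ck_on k U (partial_y f)"

definition smooth_on_plane :: "(real \<times> real) set \<Rightarrow> (real \<Rightarrow> real \<Rightarrow> real) \<Rightarrow> bool" where
  "smooth_on_plane U f \<longleftrightarrow> (\<forall>k. Ck_on k U f)"

definition curve_in :: "(real \<times> real) set \<Rightarrow> real set \<Rightarrow> (real \<Rightarrow> real) \<Rightarrow> bool" where
  "curve_in U I y \<longleftrightarrow> open I \<and> is_interval I \<and>
     (\<forall>x\<in>I. (x, y x) \<in> U \<and> y differentiable (at x) \<and> deriv y differentiable (at x))"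

text \<open>\<open>y\<close> is a solution, on the open interval \<open>I\<close> and with graph in \<open>U\<close>, of
  \<open>y'' + F\<^sub>2(x,y) y'\<^sup>2 + F\<^sub>1(x,y) y' + F(x,y) = 0\<close>.\<close>

definition is_solution ::
  "(real \<times> real) set \<Rightarrow> (real \<Rightarrow> real \<Rightarrow> real) \<Rightarrow> (real \<Rightarrow> real \<Rightarrow> real) \<Rightarrow> (real \<Rightarrow> real \<Rightarrow> real) \<Rightarrow>
   real set \<Rightarrow> (real \<Rightarrow> real) \<Rightarrow> bool" where
  "is_solution U F2 F1 F I y \<longleftrightarrow> curve_in U I y \<and>
     (\<forall>x\<in>I. deriv (deriv y) x + F2 x (y x) * (deriv y x)\<^sup>2 + F1 x (y x) * deriv y x + F x (y x) = 0)"

definition is_first_integral ::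
  "(real \<times> real) set \<Rightarrow> (real \<Rightarrow> real \<Rightarrow> real) \<Rightarrow> (real \<Rightarrow> real \<Rightarrow> real) \<Rightarrow> (real \<Rightarrow> real \<Rightarrow> real) \<Rightarrow>
   (real \<Rightarrow> real \<Rightarrow> real \<Rightarrow> real) \<Rightarrow> bool" where
  "is_first_integral U F2 F1 F w \<longleftrightarrow>
     (\<forall>I y. is_solution U F2 F1 F I y \<longrightarrow>
        (\<forall>x\<in>I. ((\<lambda>s. w s (y s) (deriv y s)) has_real_derivative 0) (at x)))"

text \<open>The generalized Sundman transformation \<open>u(t) = \<psi>(x,y)\<close>, \<open>dt = \<phi>(x,y) dx\<close> along the
  curve \<open>y\<close>: the new independent variable is a function \<open>t\<close> of \<open>x\<close> which depends on the whole
  curve and is unique only up to an additive constant, so this is a relation.  On \<open>t ` I\<close> the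
  function \<open>u\<close> is then determined, because \<open>t\<close> is strictly monotone when \<open>\<phi>\<close> does not vanish.\<close>

definition sundman_image ::
  "(real \<Rightarrow> real \<Rightarrow> real) \<Rightarrow> (real \<Rightarrow> real \<Rightarrow> real) \<Rightarrow> real set \<Rightarrow> (real \<Rightarrow> real) \<Rightarrow>
   (real \<Rightarrow> real) \<Rightarrow> (real \<Rightarrow> real) \<Rightarrow> bool" where
  "sundman_image \<psi> \<phi> I y t u \<longleftrightarrow>
     (\<forall>x\<in>I. (t has_real_derivative \<phi> x (y x)) (at x) \<and> u (t x) = \<psi> x (y x))"

text \<open>The transformation takes the equation to the free particle equation \<open>u\<^sub>t\<^sub>t = 0\<close> (the equation
  with three zero coefficients): a curve is a solution exactly when its image is one.\<close>

definition S_linearizable ::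
  "(real \<times> real) set \<Rightarrow> (real \<Rightarrow> real \<Rightarrow> real) \<Rightarrow> (real \<Rightarrow> real \<Rightarrow> real) \<Rightarrow> (real \<Rightarrow> real \<Rightarrow> real) \<Rightarrow> bool"
  where
  "S_linearizable U F2 F1 F \<longleftrightarrow>
     (\<exists>\<psi> \<phi>. smooth_on_plane U \<psi> \<and> smooth_on_plane U \<phi> \<and>
        (\<forall>(x, y)\<in>U. partial_y \<psi> x y * \<phi> x y \<noteq> 0) \<and>
        (\<forall>I y t u. curve_in U I y \<and> sundman_image \<psi> \<phi> I y t u \<longrightarrow>
           (is_solution U F2 F1 F I y \<longleftrightarrow>
            is_solution UNIV (\<lambda>_ _. 0) (\<lambda>_ _. 0) (\<lambda>_ _. 0) (t ` I) u)))"

end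

theory Submission
  imports Defs
begin

text \<open>Since \<open>h\<^sub>y = F\<^sub>2\<close>, the derivative of \<open>A y' + B\<close> along solutions vanishes as soon as
  \<open>B\<^sub>x = G := F e\<^sup>h\<close> and \<open>B\<^sub>y = K := e\<^sup>h (F\<^sub>1 - h\<^sub>x)\<close>. The hypothesis on \<open>g\<close> says exactly that
  \<open>K\<^sub>x = L := e\<^sup>h (F\<^sub>y + F F\<^sub>2)\<close>, and \<open>G\<^sub>y = L\<close> always holds. So \<open>G dx + K dy\<close> is closed; moreover
  \<open>K(x,y) - \<integral> L dx\<close>, taken from \<open>x\<^sub>0\<close> to \<open>x\<close>, equals \<open>K(x\<^sub>0,y)\<close>, which shows that the given \<open>B\<close> is the
  potential obtained by integrating the form along \<open>(x\<^sub>0,y\<^sub>0) \<rightarrow> (x\<^sub>0,y) \<rightarrow> (x,y)\<close>.\<close>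

section \<open>Smooth functions of two variables and their slices\<close>

lemma smooth_on_planeD:
  assumes "smooth_on_plane U f"
  shows smooth_on_plane_continuous: "continuous_on U (\<lambda>(x, y). f x y)"
    and smooth_on_plane_partial_x: "smooth_on_plane U (partial_x f)"
    and smooth_on_plane_partial_y: "smooth_on_plane U (partial_y f)"
    and smooth_on_plane_deriv_x:
      "(x, y) \<in> U \<Longrightarrow> ((\<lambda>s. f s y) has_real_derivative partial_x f x y) (at x)"
    and smooth_on_plane_deriv_y:
      "(x, y) \<in> U \<Longrightarrow> ((\<lambda>s. f x s) has_real_derivative partial_y f x y) (at y)"
proof -
  have *: "Ck_on (Suc k) U f" for k
    using assms unfolding smooth_on_plane_def by blast
  show "continuous_on U (\<lambda>(x, y). f x y)"
    using *[of 0] by simp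
  show "smooth_on_plane U (partial_x f)" "smooth_on_plane U (partial_y f)"
    using * by (simp_all add: smooth_on_plane_def)
  show "((\<lambda>s. f s y) has_real_derivative partial_x f x y) (at x)" if "(x, y) \<in> U"
    using *[of 0] that by (auto simp: partial_x_def DERIV_deriv_iff_real_differentiable)
  show "((\<lambda>s. f x s) has_real_derivative partial_y f x y) (at y)" if "(x, y) \<in> U"
    using *[of 0] that by (auto simp: partial_y_def DERIV_deriv_iff_real_differentiable)
qed

lemma continuous_on_slices:
  assumes "continuous_on (A \<times> B) (\<lambda>(x, y). f x y)"
  shows continuous_on_fst_slice: "y \<in> B \<Longrightarrow> continuous_on A (\<lambda>x. f x y)"
    and continuous_on_snd_slice: "x \<in> A \<Longrightarrow> continuous_on B (\<lambda>y. f x y)"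
proof -
  have "continuous_on A (\<lambda>x. case (x, y) of (x, y) \<Rightarrow> f x y)" if "y \<in> B"
    by (rule continuous_on_compose2[OF assms]) (use that in \<open>auto intro!: continuous_intros\<close>)
  then show "continuous_on A (\<lambda>x. f x y)" if "y \<in> B"
    using that by simp
  have "continuous_on B (\<lambda>y. case (x, y) of (x, y) \<Rightarrow> f x y)" if "x \<in> A"
    by (rule continuous_on_compose2[OF assms]) (use that in \<open>auto intro!: continuous_intros\<close>)
  then show "continuous_on B (\<lambda>y. f x y)" if "x \<in> A"
    using that by simp
qed

section \<open>Differentiating interval integrals, the chain rule along a curve, potentials of
  closed forms\<close>

lemma interval_integral_has_real_derivative:
  fixes f :: "real \<Rightarrow> real" and a b c x :: real
  assumes cont: "continuous_on {a<..<b} f" and c: "c \<in> {a<..<b}" and x: "x \<in> {a<..<b}"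
  shows "((\<lambda>u. LBINT s=c..u. f s) has_real_derivative f x) (at x)"
proof -
  \<comment> \<open>The fundamental theorem yields a derivative within a closed interval only. With
    \<open>c\<close> and \<open>x\<close> strictly between \<open>a'\<close> and \<open>b'\<close>,
    it becomes a two-sided derivative at \<open>x\<close>.\<close>
  obtain a' where a': "a < a'" "a' < min c x"
    using dense[of a "min c x"] c x by auto
  obtain b' where b': "max c x < b'" "b' < b"
    using dense[of "max c x" b] c x by auto
  have "continuous_on {a'..b'} f"
    using a' b' by (intro continuous_on_subset[OF cont]) auto
  then have "((\<lambda>u. LBINT s=c..u. f s) has_vector_derivative f x) (at x within {a'..b'})"
    using a' b' by (intro interval_integral_FTC2) auto
  moreover have "at x within {a'..b'} = at x"
    using a' b' by (intro at_within_interior) auto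
  ultimately show ?thesis
    by (simp add: has_real_derivative_iff_has_vector_derivative)
qed

text \<open>For ordered endpoints the interval integral is an ordinary integral over a compact
  interval, so the Leibniz rule applies. The order of \<open>p\<close> and \<open>q\<close> is left
  open because a point of the rectangle may lie on either side of the base point; reversing the
  endpoints negates both integrals.\<close>

lemma interval_integral_deriv_parameter:
  fixes f f' :: "real \<Rightarrow> real \<Rightarrow> real" and a b c d p q y :: real
  assumes deriv: "\<And>s y. s \<in> {a<..<b} \<Longrightarrow> y \<in> {c<..<d} \<Longrightarrow>
      ((\<lambda>y. f s y) has_real_derivative f' s y) (at y)"
    and cont_f: "continuous_on ({a<..<b} \<times> {c<..<d}) (\<lambda>(s, y). f s y)"
    and cont_f': "continuous_on ({a<..<b} \<times> {c<..<d}) (\<lambda>(s, y). f' s y)"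
    and p: "p \<in> {a<..<b}" and q: "q \<in> {a<..<b}" and y: "y \<in> {c<..<d}"
  shows "((\<lambda>y. LBINT s=p..q. f s y) has_real_derivative (LBINT s=p..q. f' s y)) (at y)"
proof -
  have le: "((\<lambda>y. LBINT s=p..q. f s y) has_real_derivative (LBINT s=p..q. f' s y)) (at y)"
    if "p \<le> q" "p \<in> {a<..<b}" "q \<in> {a<..<b}" for p q
  proof -
    have slice: "continuous_on {p..q} (\<lambda>s. k s r)"
      if "continuous_on ({a<..<b} \<times> {c<..<d}) (\<lambda>(s, y). k s y)" "r \<in> {c<..<d}"
      for k :: "real \<Rightarrow> real \<Rightarrow> real" and r
      using \<open>p \<in> _\<close> \<open>q \<in> _\<close>
      by (intro continuous_on_subset[OF continuous_on_fst_slice[OF that]]) auto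
    have eq: "(LBINT s=p..q. k s r) = integral {p..q} (\<lambda>s. k s r)"
      if "continuous_on ({a<..<b} \<times> {c<..<d}) (\<lambda>(s, y). k s y)" "r \<in> {c<..<d}"
      for k :: "real \<Rightarrow> real \<Rightarrow> real" and r
      using slice[OF that] \<open>p \<le> q\<close>
      by (intro interval_integral_eq_integral borel_integrable_atLeastAtMost') auto
    have "((\<lambda>y. integral (cbox p q) (\<lambda>s. f s y)) has_real_derivative
        integral (cbox p q) (\<lambda>s. f' s y)) (at y within {c<..<d})"
    proof (rule leibniz_rule_field_derivative)
      show "((\<lambda>x. f t x) has_real_derivative f' t r) (at r within {c<..<d})"
        if "r \<in> {c<..<d}" "t \<in> cbox p q" for r t
        using that \<open>p \<in> _\<close> \<open>q \<in> _\<close> by (intro DERIV_subset[OF deriv]) auto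
      show "(\<lambda>s. f s r) integrable_on cbox p q" if "r \<in> {c<..<d}" for r
        using slice[OF cont_f that] by (auto intro: integrable_continuous_interval)
      \<comment> \<open>The Leibniz rule takes the parameter as first coordinate, whereas
        \<open>f'\<close> has it second; the swap \<open>(snd z, fst z)\<close> reconciles the
        two.\<close>
      show "continuous_on ({c<..<d} \<times> cbox p q) (\<lambda>(x, t). f' t x)"
        using continuous_on_compose2[OF cont_f', of "{c<..<d} \<times> cbox p q" "\<lambda>z. (snd z, fst z)"]
          \<open>p \<in> _\<close> \<open>q \<in> _\<close> by (force intro!: continuous_intros simp: case_prod_unfold)
    qed (use y in auto)
    then have "((\<lambda>y. integral {p..q} (\<lambda>s. f s y)) has_real_derivative (LBINT s=p..q. f' s y)) (at y)"
      using y by (simp add: at_within_open[of y "{c<..<d}"] eq[OF cont_f'])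
    then show ?thesis
      by (rule has_field_derivative_transform_within_open[of _ _ _ "{c<..<d}"])
        (use y eq[OF cont_f] in auto)
  qed
  show ?thesis
  proof (cases "p \<le> q")
    case False
    then have "((\<lambda>y. - (LBINT s=q..p. f s y)) has_real_derivative - (LBINT s=q..p. f' s y)) (at y)"
      using p q by (intro DERIV_minus le) auto
    then show ?thesis
      by (simp add: interval_integral_endpoints_reverse[of "ereal p" "ereal q"])
  qed (use le p q in blast)
qed

text \<open>Existence of \<open>fx\<close> together with continuity of \<open>fy\<close> makes
  \<open>f\<close> totally differentiable on the rectangle. Composition with the graph map
  \<open>s\<close> to \<open>(s, y s)\<close> then gives the formula.\<close>

lemma chain_rule_partials:
  fixes f fx fy :: "real \<Rightarrow> real \<Rightarrow> real" and a b c d x y' :: real and y :: "real \<Rightarrow> real"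
  assumes dx: "\<And>x y. x \<in> {a<..<b} \<Longrightarrow> y \<in> {c<..<d} \<Longrightarrow>
      ((\<lambda>s. f s y) has_real_derivative fx x y) (at x)"
    and dy: "\<And>x y. x \<in> {a<..<b} \<Longrightarrow> y \<in> {c<..<d} \<Longrightarrow>
      ((\<lambda>s. f x s) has_real_derivative fy x y) (at y)"
    and cont: "continuous_on ({a<..<b} \<times> {c<..<d}) (\<lambda>(x, y). fy x y)"
    and x: "x \<in> {a<..<b}" "y x \<in> {c<..<d}"
    and y: "(y has_real_derivative y') (at x)"
  shows "((\<lambda>s. f s (y s)) has_real_derivative fx x (y x) + fy x (y x) * y') (at x)"
proof -
  let ?R = "{a<..<b} \<times> {c<..<d}"
  \<comment> \<open>\<open>fy\<close> is turned into a bounded linear operator, the form in which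
    \<open>has_derivative_partialsI\<close> expects the continuous partial derivative.\<close>
  have "continuous_on ?R (\<lambda>(x, y). blinfun_mult_right (fy x y))"
    using bounded_linear.continuous_on[OF bounded_linear_blinfun_mult_right cont]
    by (simp add: case_prod_unfold)
  then have "continuous (at (x, y x) within ?R) (\<lambda>(x, y). blinfun_mult_right (fy x y))"
    using x by (simp add: continuous_on_eq_continuous_within)
  then have "((\<lambda>(x, y). f x y) has_derivative
      (\<lambda>(u, v). fx x (y x) * u + blinfun_mult_right (fy x (y x)) v)) (at (x, y x) within ?R)"
    using x dx[of x "y x"] dy
    by (intro has_derivative_partialsI)
      (auto simp: has_field_derivative_def intro: has_derivative_at_withinI)
  then have "((\<lambda>(x, y). f x y) has_derivative (\<lambda>(u, v). fx x (y x) * u + fy x (y x) * v))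
      (at (x, y x))"
    using x by (simp add: at_within_open[of "(x, y x)" ?R] open_Times)
  moreover have "((\<lambda>s. (s, y s)) has_derivative (\<lambda>u. (u, y' * u))) (at x)"
    using y by (auto intro!: derivative_eq_intros simp: has_field_derivative_def)
  ultimately have *: "((\<lambda>s. case (s, y s) of (x, y) \<Rightarrow> f x y) has_derivative
      (\<lambda>u. case (u, y' * u) of (u, v) \<Rightarrow> fx x (y x) * u + fy x (y x) * v)) (at x)"
    by (rule has_derivative_compose[where f = "\<lambda>s. (s, y s)", rotated])
  show ?thesis
    unfolding has_field_derivative_def
    by (rule has_derivative_eq_rhs[OF *[unfolded prod.case]]) (simp add: fun_eq_iff algebra_simps)
qed

text \<open>\<open>L\<close> is the common value of the cross derivatives of \<open>G\<close> and
  \<open>K\<close>, so \<open>G dx + K dy\<close> is closed. \<open>B\<close> keeps the shape of the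
  nested integrals in the claimed formula.\<close>

lemma closed_form_potential:
  fixes G K L :: "real \<Rightarrow> real \<Rightarrow> real" and a b c d x0 y0 x y :: real
  defines "B \<equiv> \<lambda>x y. (LBINT s=x0..x. G s y) + (LBINT r=y0..y. K x r - (LBINT s=x0..x. L s r))"
  assumes cont_G: "continuous_on ({a<..<b} \<times> {c<..<d}) (\<lambda>(x, y). G x y)"
    and cont_K: "continuous_on ({a<..<b} \<times> {c<..<d}) (\<lambda>(x, y). K x y)"
    and cont_L: "continuous_on ({a<..<b} \<times> {c<..<d}) (\<lambda>(x, y). L x y)"
    and G_y: "\<And>x y. x \<in> {a<..<b} \<Longrightarrow> y \<in> {c<..<d} \<Longrightarrow>
      ((\<lambda>s. G x s) has_real_derivative L x y) (at y)"
    and K_x: "\<And>x y. x \<in> {a<..<b} \<Longrightarrow> y \<in> {c<..<d} \<Longrightarrow>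
      ((\<lambda>s. K s y) has_real_derivative L x y) (at x)"
    and x0: "x0 \<in> {a<..<b}" and y0: "y0 \<in> {c<..<d}"
    and x: "x \<in> {a<..<b}" and y: "y \<in> {c<..<d}"
  shows "((\<lambda>s. B s y) has_real_derivative G x y) (at x)"
    and "((\<lambda>s. B x s) has_real_derivative K x y) (at y)"
proof -
  have FTC: "(LBINT s=x0..u. L s r) = K u r - K x0 r" if "u \<in> {a<..<b}" "r \<in> {c<..<d}" for u r
  proof (rule interval_integral_FTC_finite)
    show "continuous_on {min x0 u..max x0 u} (\<lambda>s. L s r)"
      using that x0 by (intro continuous_on_subset[OF continuous_on_fst_slice[OF cont_L]]) auto
    show "((\<lambda>s. K s r) has_vector_derivative L t r) (at t within {min x0 u..max x0 u})"
      if "min x0 u \<le> t" "t \<le> max x0 u" for t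
      unfolding has_real_derivative_iff_has_vector_derivative[symmetric]
      using that x0 \<open>u \<in> _\<close> \<open>r \<in> _\<close> by (intro DERIV_subset[OF K_x]) auto
  qed
  \<comment> \<open>By \<open>FTC\<close> the integrand in \<open>r\<close> collapses to
    \<open>K x0 r\<close>, so the second integral no longer depends on \<open>u\<close>.
    Differentiation in \<open>x\<close> therefore sees only the integral of
    \<open>G\<close>.\<close>
  have B: "(LBINT s=x0..u. G s r) + (LBINT t=y0..r. K x0 t) = B u r"
    if "u \<in> {a<..<b}" "r \<in> {c<..<d}" for u r
    unfolding B_def
    by (rule arg_cong2[where f = "(+)"], simp, rule interval_integral_cong)
      (use that y0 FTC in \<open>auto simp: einterval_iff min_def max_def split: if_splits\<close>)
  have "((\<lambda>u. (LBINT s=x0..u. G s y) + (LBINT t=y0..y. K x0 t)) has_real_derivative G x y) (at x)"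
    using x x0 y
    by (auto intro!: derivative_eq_intros interval_integral_has_real_derivative continuous_on_fst_slice[OF cont_G])
  then show "((\<lambda>s. B s y) has_real_derivative G x y) (at x)"
    by (rule has_field_derivative_transform_within_open[of _ _ _ "{a<..<b}"]) (use x y B in auto)
  \<comment> \<open>Differentiating under the first integral gives the integral of \<open>L\<close>,
    which is \<open>K x y - K x0 y\<close>; the second integral contributes the missing
    \<open>K x0 y\<close>.\<close>
  have "((\<lambda>r. (LBINT s=x0..x. G s r) + (LBINT t=y0..r. K x0 t)) has_real_derivative
      (LBINT s=x0..x. L s y) + K x0 y) (at y)"
    by (intro DERIV_add interval_integral_deriv_parameter[of a b c d]
        interval_integral_has_real_derivative[of c d])
      (use G_y cont_G cont_L x0 x y0 y continuous_on_snd_slice[OF cont_K] in auto)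
  then have "((\<lambda>r. (LBINT s=x0..x. G s r) + (LBINT t=y0..r. K x0 t)) has_real_derivative K x y) (at y)"
    unfolding FTC[OF x y] by simp
  then show "((\<lambda>s. B x s) has_real_derivative K x y) (at y)"
    by (rule has_field_derivative_transform_within_open[of _ _ _ "{c<..<d}"]) (use x y B in auto)
qed

theorem theorem2p3:
  fixes F2 F1 F H h :: "real \<Rightarrow> real \<Rightarrow> real"
    and g :: "real \<Rightarrow> real"
    and a b c d x0 y0 :: real
    and R :: "(real \<times> real) set"
  assumes R: "R = {a<..<b} \<times> {c<..<d}" and base_point: "(x0, y0) \<in> R"
    and smooth_coeffs: "smooth_on_plane R F2" "smooth_on_plane R F1" "smooth_on_plane R F"
    and S_lin: "S_linearizable R F2 F1 F"
    and smooth_H: "smooth_on_plane R H"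
    and antiderivative_H: "\<forall>(x, y)\<in>R. ((\<lambda>s. H x s) has_real_derivative F2 x y) (at y)"
    and smooth_g: "smooth_on_plane R (\<lambda>x y. g x)"
    and h: "\<forall>(x, y)\<in>R. h x y = H x y + g x"
    and h_eq: "\<forall>(x, y)\<in>R.
        partial_x F1 x y + F1 x y * partial_x h x y - (partial_x h x y)\<^sup>2
        - partial_x (partial_x h) x y - partial_y F x y - F x y * F2 x y = 0"
  shows "is_first_integral R F2 F1 F
    (\<lambda>x y p. exp (h x y) * p
      + ((LBINT s=x0..x. F s y * exp (h s y))
         + (LBINT r=y0..y. (exp (h x r) * (F1 x r - partial_x h x r)
              - (LBINT s=x0..x. exp (h s r) * (partial_y F s r + F s r * F2 s r))))))"
proof -
  let ?R = "{a<..<b} \<times> {c<..<d}"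
  define hx where "hx = partial_x h"
  define G where "G = (\<lambda>x y. F x y * exp (h x y))"
  define K where "K = (\<lambda>x y. exp (h x y) * (F1 x y - hx x y))"
  define L where "L = (\<lambda>x y. exp (h x y) * (partial_y F x y + F x y * F2 x y))"
  define B where
    "B = (\<lambda>x y. (LBINT s=x0..x. G s y) + (LBINT r=y0..y. K x r - (LBINT s=x0..x. L s r)))"
  note x0 = base_point[unfolded R mem_Times_iff fst_conv snd_conv, THEN conjunct1]
  note y0 = base_point[unfolded R mem_Times_iff fst_conv snd_conv, THEN conjunct2]
  note smooth = smooth_coeffs[unfolded R] smooth_H[unfolded R] smooth_g[unfolded R]
  note F2 = smooth(1) and F1 = smooth(2) and F = smooth(3) and H = smooth(4) and g = smooth(5)

  \<comment> \<open>Partial derivatives of \<open>h\<close>\<close>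
  have h': "h x y = H x y + g x" if "x \<in> {a<..<b}" "y \<in> {c<..<d}" for x y
    using h that by (auto simp: R)
  \<comment> \<open>\<open>h\<close> is tied to \<open>H\<close> and \<open>g\<close> on the
    rectangle only, so its derivatives are transferred from \<open>H + g\<close> there.
    \<open>k\<close> is the expression for \<open>hx\<close> in smooth data, which can be
    differentiated once more to obtain \<open>h_xx\<close>.\<close>
  define k where "k = (\<lambda>x y. partial_x H x y + partial_x (\<lambda>x y. g x) x y)"
  have h_x: "((\<lambda>s. h s y) has_real_derivative k x y) (at x)"
    if "x \<in> {a<..<b}" "y \<in> {c<..<d}" for x y
  proof (rule has_field_derivative_transform_within_open[of _ _ _ "{a<..<b}"])
    show "((\<lambda>s. H s y + g s) has_real_derivative k x y) (at x)"
      unfolding k_def using that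
      by (intro DERIV_add smooth_on_plane_deriv_x[OF H] smooth_on_plane_deriv_x[OF g]) auto
  qed (use that h' in auto)
  have hx: "hx x y = k x y" if "x \<in> {a<..<b}" "y \<in> {c<..<d}" for x y
    using DERIV_imp_deriv[OF h_x[OF that]] by (simp add: hx_def partial_x_def)
  have h_y: "((\<lambda>s. h x s) has_real_derivative F2 x y) (at y)"
    if "x \<in> {a<..<b}" "y \<in> {c<..<d}" for x y
  proof (rule has_field_derivative_transform_within_open[of _ _ _ "{c<..<d}"])
    show "((\<lambda>s. H x s + g x) has_real_derivative F2 x y) (at y)"
      using antiderivative_H that by (auto simp: R intro!: derivative_eq_intros)
  qed (use that h' in auto)
  have h_xx: "((\<lambda>s. hx s y) has_real_derivative partial_x hx x y) (at x)"
    if "x \<in> {a<..<b}" "y \<in> {c<..<d}" for x y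
  proof -
    have "((\<lambda>s. k s y) has_real_derivative
        partial_x (partial_x H) x y + partial_x (partial_x (\<lambda>x y. g x)) x y) (at x)"
      unfolding k_def using that
      by (intro DERIV_add smooth_on_plane_deriv_x[OF smooth_on_plane_partial_x[OF H]]
          smooth_on_plane_deriv_x[OF smooth_on_plane_partial_x[OF g]]) auto
    then have "((\<lambda>s. hx s y) has_real_derivative
        partial_x (partial_x H) x y + partial_x (partial_x (\<lambda>x y. g x)) x y) (at x)"
      by (rule has_field_derivative_transform_within_open[of _ _ _ "{a<..<b}"]) (use that hx in auto)
    then show ?thesis
      using DERIV_imp_deriv[of "\<lambda>s. hx s y"] by (simp add: partial_x_def)
  qed

  \<comment> \<open>Continuity of \<open>G\<close>, \<open>K\<close> and \<open>L\<close>\<close>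
  note smooth_on_plane_continuous[OF F2, unfolded case_prod_unfold, continuous_intros]
    smooth_on_plane_continuous[OF F1, unfolded case_prod_unfold, continuous_intros]
    smooth_on_plane_continuous[OF F, unfolded case_prod_unfold, continuous_intros]
    smooth_on_plane_continuous[OF smooth_on_plane_partial_y[OF F],
      unfolded case_prod_unfold, continuous_intros]
  have "continuous_on ?R (\<lambda>z. H (fst z) (snd z) + g (fst z))"
    using smooth_on_plane_continuous[OF H] smooth_on_plane_continuous[OF g]
    by (auto simp: case_prod_unfold intro!: continuous_intros)
  then have [continuous_intros]: "continuous_on ?R (\<lambda>z. h (fst z) (snd z))"
    by (rule continuous_on_eq) (use h' in auto)
  have "continuous_on ?R (\<lambda>z. k (fst z) (snd z))"
    using smooth_on_plane_continuous[OF smooth_on_plane_partial_x[OF H]]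
      smooth_on_plane_continuous[OF smooth_on_plane_partial_x[OF g]]
    by (auto simp: k_def case_prod_unfold intro!: continuous_intros)
  then have [continuous_intros]: "continuous_on ?R (\<lambda>z. hx (fst z) (snd z))"
    by (rule continuous_on_eq) (use hx in auto)
  have cont: "continuous_on ?R (\<lambda>(x, y). G x y)" "continuous_on ?R (\<lambda>(x, y). K x y)"
    "continuous_on ?R (\<lambda>(x, y). L x y)"
    unfolding G_def K_def L_def case_prod_unfold by (intro continuous_intros)+

  \<comment> \<open>Closedness of \<open>G dx + K dy\<close>\<close>
  have G_y: "((\<lambda>s. G x s) has_real_derivative L x y) (at y)"
    if "x \<in> {a<..<b}" "y \<in> {c<..<d}" for x y
    unfolding G_def L_def using that
    by (auto intro!: derivative_eq_intros smooth_on_plane_deriv_y[OF F] h_y simp: algebra_simps)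
  have K_x: "((\<lambda>s. K s y) has_real_derivative L x y) (at x)"
    if "x \<in> {a<..<b}" "y \<in> {c<..<d}" for x y
  proof -
    \<comment> \<open>The left side is the factor of \<open>exp h\<close> in the
      \<open>x\<close>-derivative of \<open>K\<close>: the product rule gives
      \<open>hx * (F1 - hx)\<close> plus the \<open>x\<close>-derivative of
      \<open>F1 - hx\<close>.\<close>
    have "partial_x F1 x y + F1 x y * hx x y - (hx x y)\<^sup>2 - partial_x hx x y
        = partial_y F x y + F x y * F2 x y"
      using h_eq that by (auto simp: R hx_def algebra_simps)
    then have "L x y = exp (h x y) *
        (partial_x F1 x y + F1 x y * hx x y - (hx x y)\<^sup>2 - partial_x hx x y)"
      by (simp add: L_def)
    then show ?thesis
      unfolding K_def using that
      by (auto intro!: derivative_eq_intros smooth_on_plane_deriv_x[OF F1] h_xx h_x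
          simp: hx algebra_simps power2_eq_square)
  qed

  \<comment> \<open>Derivative of \<open>w\<close> along a solution\<close>
  have "((\<lambda>s. exp (h s (y s)) * deriv y s + B s (y s)) has_real_derivative 0) (at x)"
    if sol: "is_solution R F2 F1 F I y" and "x \<in> I" for I y x
  proof -
    have x: "x \<in> {a<..<b}" "y x \<in> {c<..<d}"
      and dy: "(y has_real_derivative deriv y x) (at x)"
      and ddy: "(deriv y has_real_derivative deriv (deriv y) x) (at x)"
      and ode: "deriv (deriv y) x
        = - (F2 x (y x) * (deriv y x)\<^sup>2 + F1 x (y x) * deriv y x + F x (y x))"
      using that by (auto simp: is_solution_def curve_in_def R DERIV_deriv_iff_real_differentiable
          algebra_simps eq_neg_iff_add_eq_0)
    have h_chain: "((\<lambda>s. h s (y s)) has_real_derivative hx x (y x) + F2 x (y x) * deriv y x) (at x)"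
      by (rule chain_rule_partials[where f = h, OF _ h_y smooth_on_plane_continuous[OF F2] x dy])
        (use h_x hx in auto)
    have B_chain: "((\<lambda>s. B s (y s)) has_real_derivative G x (y x) + K x (y x) * deriv y x) (at x)"
      unfolding B_def
      by (rule chain_rule_partials[where fx = G and fy = K, OF _ _ cont(2) x dy];
          rule closed_form_potential[OF cont G_y K_x x0 y0])
    \<comment> \<open>With \<open>p = deriv y x\<close>, the terms \<open>hx * p\<close> from
      \<open>h_chain\<close> and \<open>B_chain\<close> cancel. What remains is \<open>exp h\<close>
      times \<open>y'' + F2 * p^2 + F1 * p + F\<close>, which vanishes by
      \<open>ode\<close>.\<close>
    show ?thesis
      by (rule derivative_eq_intros h_chain B_chain ddy refl)+
        (simp add: ode G_def K_def algebra_simps power2_eq_square)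
  qed
  then show ?thesis
    by (simp add: is_first_integral_def B_def G_def K_def L_def hx_def)
qed

end
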